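(* Fix a real number $\gamma>1$ and an integer $k\ge2$. Let $\Gamma=\Gamma_{k,\gamma}$ and let $S_\Gamma(r)=\{v\in\mathscr{V}(\Gamma)\mid d(v,O)\le r\}$, where $\mathscr{V}(\Gamma)$ is the set of vertices of $\Gamma$, $O$ is the root and $d$ is the graph distance. Then $$\limsup_{r\to\infty}\frac{\log\#S_\Gamma(r)}{\log r}=\liminf_{r\to\infty}\frac{\log\#S_\Gamma(r)}{\log r}=\frac{\log(\gamma k)}{\log\gamma}.$$
   Context: A rooted tree with root $O$ is spherically homogeneous (SH) if every vertex at distance $j$ from $O$ is joined to exactly $\kappa_j$ vertices at distance $j+1$ from $O$; it is determined by $\{\kappa_j\}_{j\ge0}$. The tree $\Gamma_{k,\gamma}$ is the SH rooted tree of type $\{L_n,k_n\}_{n=1}^\infty$ with $L_n=[\gamma^n]$ ($[\cdot]$ is the integer part) and $k_n\equiv k$; that is, $\kappa_j=k$ if $j=[\gamma^n]$ for some $n\ge1$ and $\kappa_j=1$ otherwise. $\#A$ denotes the number of elements of a finite set $A$. *)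

theory Defs
  imports "Graph_Theory.Graph_Theory"
begin

text \<open>
  As in \<^theory>\<open>Graph_Theory.Digraph\<close>, a simple undirected graph is a symmetric, loop-free digraph
  without parallel arcs; an edge is then a pair of mutually inverse arcs.
\<close>

context wf_digraph
begin

definition graph_dist :: "'a \<Rightarrow> 'a \<Rightarrow> ereal" where
  "graph_dist u v = \<mu> (\<lambda>_. 1) u v"

end

text \<open>
  Walking along an edge and back is a cycle of length 2 in the sense of the library, so its
  notions of forest and tree are not the undirected ones. In a loop-free digraph without
  parallel arcs the undirected cycles are exactly the cycles of length at least 3. The
  locale \<open>graph\<close> of the library is not used because it requires finiteness.
\<close>

locale rooted_tree = sym_digraph G + loopfree_digraph G + nomulti_digraph G
  for G :: "('a, 'b) pre_digraph" (structure) +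
  fixes rt :: 'a
  assumes root_in_verts: "rt \<in> verts G"
    and connected: "Digraph_Component.connected G"
    and acyclic: "cycle p \<Longrightarrow> length p \<le> 2"
begin

definition successors :: "nat \<Rightarrow> 'a \<Rightarrow> 'a set" where
  "successors j v = {w \<in> verts G. v \<rightarrow> w \<and> graph_dist w rt = ereal (real (Suc j))}"

definition spherically_homogeneous :: "(nat \<Rightarrow> nat) \<Rightarrow> bool" where
  "spherically_homogeneous \<kappa> \<longleftrightarrow>
     (\<forall>j. \<forall>v \<in> verts G. graph_dist v rt = ereal (real j) \<longrightarrow>
        finite (successors j v) \<and> card (successors j v) = \<kappa> j)"

definition root_ball :: "real \<Rightarrow> 'a set" where
  "root_ball r = {v \<in> verts G. graph_dist v rt \<le> ereal r}"

end

text \<open>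
  For \<open>\<gamma>\<close> close to 1 several \<open>n\<close> may give the same value \<open>\<lfloor>\<gamma> ^ n\<rfloor>\<close>; the branching number there is
  still \<open>k\<close>.
\<close>

definition Gamma_branching :: "nat \<Rightarrow> real \<Rightarrow> nat \<Rightarrow> nat" where
  "Gamma_branching k \<gamma> j = (if \<exists>n\<ge>1. int j = \<lfloor>\<gamma> ^ n\<rfloor> then k else 1)"

text \<open>
  A spherically homogeneous rooted tree is determined by its branching numbers only up to
  isomorphism, so \<open>\<Gamma>\<^bsub>k,\<gamma>\<^esub>\<close> is rendered as a predicate on rooted graphs.
\<close>

definition is_Gamma :: "nat \<Rightarrow> real \<Rightarrow> ('a, 'b) pre_digraph \<Rightarrow> 'a \<Rightarrow> bool" where
  "is_Gamma k \<gamma> G rt \<longleftrightarrow>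
     rooted_tree G rt \<and> rooted_tree.spherically_homogeneous G rt (Gamma_branching k \<gamma>)"

end

theory Submission
  imports Defs "HOL-Real_Asymp.Real_Asymp"
begin

text \<open>
  The exponent is the sum of two contributions. Let \<open>M j\<close> be the number of vertices at distance
  \<open>j\<close> from the root. In a tree each vertex other than the root has exactly one neighbour nearer
  to the root, so \<open>M j\<close> is the product of the branching numbers at distances below \<open>j\<close>
  (\<open>card_level\<close>), that is, \<open>k\<close> to the number of branching radii \<open>\<lfloor>\<gamma> ^ n\<rfloor>\<close> below \<open>j\<close>.
  These radii grow geometrically, so their number is \<open>log \<gamma> j\<close> up to a bounded error
  (\<open>card_branching_radii_le\<close>, \<open>card_branching_radii_ge\<close>), also when \<open>\<gamma>\<close> is so close to 1 that
  some of the first powers share their integer part. Hence \<open>M j\<close> lies between constant multiples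
  of \<open>j powr b\<close>, where \<open>b = log \<gamma> k\<close>.

  The ball of radius \<open>r\<close> consists of about \<open>r\<close> levels, and the outer half of them all have size of
  order \<open>r powr b\<close>, so its size is of order \<open>r powr (b + 1)\<close> (\<open>sum_powr_growth_bounds\<close>). The
  quotient of logarithms therefore converges to \<open>b + 1 = ln (\<gamma> * k) / ln \<gamma>\<close>, and the limit is
  both the upper and the lower one.
\<close>

section \<open>Levels of a rooted tree\<close>

context rooted_tree
begin

definition depth :: "'a \<Rightarrow> nat" where
  "depth v = (LEAST n. \<exists>p. awalk v p rt \<and> length p = n)"

definition level :: "nat \<Rightarrow> 'a set" where
  "level n = {v \<in> verts G. depth v = n}"

lemma reachable_root:
  assumes "v \<in> verts G"
  shows "v \<rightarrow>\<^sup>* rt"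
  using symmetric_connected_imp_strongly_connected[OF sym_arcs connected] assms root_in_verts
  unfolding strongly_connected_def by blast

lemma depth_le_length: "awalk v p rt \<Longrightarrow> depth v \<le> length p"
  unfolding depth_def by (rule Least_le) blast

lemma shortest_walk_to_root:
  assumes "v \<in> verts G"
  obtains p where "awalk v p rt" "length p = depth v"
proof -
  obtain p where "awalk v p rt"
    using reachable_root[OF assms] by (auto simp: reachable_awalk)
  hence "\<exists>n p'. awalk v p' rt \<and> length p' = n"
    by blast
  hence "\<exists>p'. awalk v p' rt \<and> length p' = depth v"
    unfolding depth_def by (rule LeastI_ex)
  thus ?thesis using that by blast
qed

lemma graph_dist_root:
  assumes "v \<in> verts G"
  shows "graph_dist v rt = ereal (real (depth v))"
proof -
  have cost: "awalk_cost (\<lambda>_. 1) p = real (length p)" for p :: "'b list"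
    by (induction p) auto
  obtain p where p: "awalk v p rt" "length p = depth v"
    by (rule shortest_walk_to_root[OF assms])
  show ?thesis
  proof (rule antisym)
    show "graph_dist v rt \<le> ereal (real (depth v))"
      using min_cost_le_walk_cost[OF p(1), of "\<lambda>_. 1"] p(2) by (simp add: graph_dist_def cost)
    show "ereal (real (depth v)) \<le> graph_dist v rt"
      unfolding graph_dist_def \<mu>_def by (rule INF_greatest) (auto simp: cost dest: depth_le_length)
  qed
qed

lemma depth_root [simp]: "depth rt = 0"
  using depth_le_length[of rt "[]"] root_in_verts by (simp add: awalk_Nil_iff)

lemma depth_eq_0_iff:
  assumes "v \<in> verts G"
  shows "depth v = 0 \<longleftrightarrow> v = rt"
proof
  assume "depth v = 0"
  moreover obtain p where "awalk v p rt" "length p = depth v"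
    by (rule shortest_walk_to_root[OF assms])
  ultimately show "v = rt"
    by (auto simp: awalk_Nil_iff)
qed simp

lemma adj_sym: "u \<rightarrow> v \<Longrightarrow> v \<rightarrow> u"
  by (rule arcs_ends_symmetric[OF sym_arcs])

lemma depth_adj_le:
  assumes "u \<rightarrow> v"
  shows "depth u \<le> Suc (depth v)"
proof -
  obtain e where e: "e \<in> arcs G" "tail G e = u" "head G e = v"
    using assms by auto
  obtain p where "awalk v p rt" "length p = depth v"
    using shortest_walk_to_root[of v] adj_in_verts[OF assms] by blast
  hence "awalk u (e # p) rt" "length (e # p) = Suc (depth v)"
    using e by (auto simp: awalk_Cons_iff)
  thus ?thesis
    by (metis depth_le_length)
qed

lemma parent_exists:
  assumes "v \<in> verts G" "depth v = Suc n"
  obtains u where "u \<in> level n" "u \<rightarrow> v"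
proof -
  obtain p where p: "awalk v p rt" "length p = Suc n"
    using shortest_walk_to_root[OF assms(1)] assms(2) by metis
  then obtain e q where q: "e \<in> arcs G" "tail G e = v" "awalk (head G e) q rt" "length q = n"
    by (cases p) (auto simp: awalk_Cons_iff)
  hence adj: "v \<rightarrow> head G e"
    by (intro dominatesI[of e]) (simp_all add: arc_to_ends_def)
  hence "depth (head G e) = n"
    using depth_le_length[OF q(3)] depth_adj_le[OF adj] q(4) assms(2) by simp
  thus ?thesis
    using that[of "head G e"] adj_sym[OF adj] q(1) by (simp add: level_def)
qed

text \<open>
  Climbing from parent to parent reaches the root without ever leaving the ball in which the
  climb started.
\<close>

lemma walks_via_ancestors:
  assumes "v \<in> level n"
  shows "(\<exists>p. awalk v p rt \<and> (\<forall>x \<in> set (awalk_verts v p). depth x \<le> n)) \<and>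
         (\<exists>q. awalk rt q v \<and> (\<forall>x \<in> set (awalk_verts rt q). depth x \<le> n))"
  using assms
proof (induction n arbitrary: v)
  case 0
  hence "v = rt"
    by (auto simp: level_def depth_eq_0_iff)
  thus ?case
    using root_in_verts by (intro conjI exI[of _ "[]"]) (auto simp: awalk_Nil_iff)
next
  case (Suc n)
  hence v: "v \<in> verts G" "depth v = Suc n"
    by (auto simp: level_def)
  obtain u where u: "u \<in> level n" "u \<rightarrow> v"
    by (rule parent_exists[OF v])
  obtain p q where
    p: "awalk u p rt" "\<forall>x \<in> set (awalk_verts u p). depth x \<le> n" and
    q: "awalk rt q u" "\<forall>x \<in> set (awalk_verts rt q). depth x \<le> n"
    using Suc.IH[OF u(1)] by blast
  obtain e where e: "e \<in> arcs G" "tail G e = u" "head G e = v"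
    using u(2) by auto
  obtain e' where e': "e' \<in> arcs G" "tail G e' = v" "head G e' = u"
    using adj_sym[OF u(2)] by auto
  have "awalk v (e' # p) rt \<and> (\<forall>x \<in> set (awalk_verts v (e' # p)). depth x \<le> Suc n)"
    using p e' v by (auto simp: awalk_Cons_iff)
  moreover have uv: "awalk u [e] v"
    using e v by (auto simp: awalk_Cons_iff awalk_Nil_iff)
  moreover have "\<forall>x \<in> set (awalk_verts rt (q @ [e])). depth x \<le> Suc n"
    using q e v u(1) by (auto simp: set_awalk_verts_append[OF q(1) uv] level_def)
  ultimately show ?case
    using awalk_appendI[OF q(1) uv] by blast
qed

text \<open>
  Two parents of \<open>w\<close> are joined by a path that passes only through depths below that of \<open>w\<close>.
  Closing it up through \<open>w\<close> would give a cycle with at least three vertices.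
\<close>

lemma parent_unique:
  assumes "u \<in> level n" "u' \<in> level n" "u \<rightarrow> w" "u' \<rightarrow> w" "depth w = Suc n"
  shows "u = u'"
proof (rule ccontr)
  assume "u \<noteq> u'"
  obtain p where p: "awalk u p rt" "\<forall>x \<in> set (awalk_verts u p). depth x \<le> n"
    using walks_via_ancestors[OF assms(1)] by blast
  obtain q where q: "awalk rt q u'" "\<forall>x \<in> set (awalk_verts rt q). depth x \<le> n"
    using walks_via_ancestors[OF assms(2)] by blast
  define s where "s = awalk_to_apath (p @ q)"
  have pq: "awalk u (p @ q) u'"
    using p(1) q(1) by (rule awalk_appendI)
  have "apath u s u'"
    unfolding s_def using pq by (rule apath_awalk_to_apath)
  hence s: "awalk u s u'" "distinct (awalk_verts u s)"
    by (auto simp: apath_def)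
  have "set s \<subseteq> set (p @ q)"
    unfolding s_def using pq by (rule awalk_to_apath_subset)
  hence "set (awalk_verts u s) \<subseteq> set (awalk_verts u (p @ q))"
    unfolding set_awalk_verts[OF pq] set_awalk_verts[OF s(1)] by auto
  hence "\<forall>x \<in> set (awalk_verts u s). depth x \<le> n"
    using p(2) q(2) set_awalk_verts_append[OF p(1) q(1)] by blast
  hence w: "w \<notin> set (awalk_verts u s)"
    using assms(5) by fastforce
  have "s \<noteq> []"
    using s(1) \<open>u \<noteq> u'\<close> by (auto simp: awalk_Nil_iff)
  obtain a where a: "a \<in> arcs G" "tail G a = w" "head G a = u"
    using adj_sym[OF assms(3)] by auto
  obtain b where b: "b \<in> arcs G" "tail G b = u'" "head G b = w"
    using assms(4) by auto
  have "awalk u' [b] w"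
    using b by (auto simp: awalk_Cons_iff awalk_Nil_iff)
  hence sb: "awalk u (s @ [b]) w"
    using s(1) by (rule awalk_appendI[rotated])
  have "awlast u s = u'"
    using s(1) by auto
  hence "awalk_verts u (s @ [b]) = awalk_verts u s @ [w]"
    using awalk_verts_append[OF sb] b by simp
  hence "cycle (a # s @ [b])"
    unfolding cycle_def using sb a s(2) w by (intro exI[of _ w]) (auto simp: awalk_Cons_iff)
  hence "length (a # s @ [b]) \<le> 2"
    by (rule acyclic)
  thus False
    using \<open>s \<noteq> []\<close> by (cases s) auto
qed

lemma successors_eq:
  "successors n v = {w \<in> level (Suc n). v \<rightarrow> w}"
  by (auto simp: successors_def level_def graph_dist_root)

lemma level_0: "level 0 = {rt}"
  using root_in_verts by (auto simp: level_def depth_eq_0_iff)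

lemma level_Suc: "level (Suc n) = (\<Union>u\<in>level n. successors n u)"
proof
  show "level (Suc n) \<subseteq> (\<Union>u\<in>level n. successors n u)"
  proof
    fix w assume w: "w \<in> level (Suc n)"
    then obtain u where "u \<in> level n" "u \<rightarrow> w"
      using parent_exists[of w n] by (auto simp: level_def)
    thus "w \<in> (\<Union>u\<in>level n. successors n u)"
      using w by (auto simp: successors_eq)
  qed
qed (auto simp: successors_eq)

lemma card_level:
  assumes "spherically_homogeneous \<kappa>"
  shows "finite (level n) \<and> card (level n) = (\<Prod>i<n. \<kappa> i)"
proof (induction n)
  case 0
  show ?case by (simp add: level_0)
next
  case (Suc n)
  have succ: "finite (successors n u) \<and> card (successors n u) = \<kappa> n" if "u \<in> level n" for u
    using assms that by (auto simp: spherically_homogeneous_def level_def graph_dist_root)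
  have "successors n u \<inter> successors n u' = {}"
    if "u \<in> level n" "u' \<in> level n" "u \<noteq> u'" for u u'
    using parent_unique[OF that(1,2)] that(3) by (auto simp: successors_eq level_def)
  hence "card (level (Suc n)) = (\<Sum>u\<in>level n. card (successors n u))"
    unfolding level_Suc using Suc.IH succ by (intro card_UN_disjoint) auto
  also have "\<dots> = (\<Prod>i<Suc n. \<kappa> i)"
    using Suc.IH succ by simp
  finally show ?case
    using Suc.IH succ by (auto simp: level_Suc)
qed

lemma card_root_ball:
  assumes "spherically_homogeneous \<kappa>" "r \<ge> 0"
  shows "card (root_ball r) = (\<Sum>n\<le>nat \<lfloor>r\<rfloor>. \<Prod>i<n. \<kappa> i)"
proof -
  have "real (depth v) \<le> r \<longleftrightarrow> depth v \<le> nat \<lfloor>r\<rfloor>" for v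
    using assms(2) by (simp add: le_nat_iff le_floor_iff)
  hence "root_ball r = (\<Union>n\<in>{..nat \<lfloor>r\<rfloor>}. level n)"
    by (auto simp: root_ball_def level_def graph_dist_root)
  also have "card \<dots> = (\<Sum>n\<le>nat \<lfloor>r\<rfloor>. card (level n))"
    using card_level[OF assms(1)] by (intro card_UN_disjoint) (auto simp: level_def)
  finally show ?thesis
    using card_level[OF assms(1)] by simp
qed

end


section \<open>Counting the branching radii\<close>

definition branching_radii :: "real \<Rightarrow> nat set" where
  "branching_radii \<gamma> = {j. \<exists>n\<ge>1. int j = \<lfloor>\<gamma> ^ n\<rfloor>}"

lemma prod_Gamma_branching:
  "(\<Prod>i<j. Gamma_branching k \<gamma> i) = k ^ card (branching_radii \<gamma> \<inter> {..<j})"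
proof -
  have "(\<Prod>i<j. Gamma_branching k \<gamma> i) = (\<Prod>i\<in>{..<j}. if i \<in> branching_radii \<gamma> then k else 1)"
    by (simp add: Gamma_branching_def branching_radii_def)
  also have "\<dots> = (\<Prod>i\<in>{..<j} \<inter> branching_radii \<gamma>. k)"
    by (rule prod.inter_restrict[symmetric]) simp
  finally show ?thesis
    by (simp add: Int_commute)
qed

lemma power_less_iff_less_log:
  fixes \<gamma> x :: real
  assumes "\<gamma> > 1" "x > 0"
  shows "\<gamma> ^ n < x \<longleftrightarrow> real n < log \<gamma> x"
  using assms by (simp add: less_log_iff powr_realpow)

text \<open>
  A radius below \<open>j\<close> comes from an exponent \<open>n\<close> with \<open>\<gamma> ^ n < j\<close>. Exponents that share an
  integer part are counted once as radii, which only helps here.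
\<close>

lemma card_branching_radii_le:
  assumes "\<gamma> > 1" "j \<ge> 1"
  shows "real (card (branching_radii \<gamma> \<inter> {..<j})) \<le> log \<gamma> (real j)"
proof -
  define N where "N = {n. n \<ge> 1 \<and> \<gamma> ^ n < real j}"
  have N: "N \<subseteq> {1..nat \<lfloor>log \<gamma> (real j)\<rfloor>}"
    using assms by (auto simp: N_def power_less_iff_less_log le_nat_floor)
  hence "finite N"
    by (rule finite_subset) simp
  have "branching_radii \<gamma> \<inter> {..<j} \<subseteq> (\<lambda>n. nat \<lfloor>\<gamma> ^ n\<rfloor>) ` N"
  proof
    fix i assume i: "i \<in> branching_radii \<gamma> \<inter> {..<j}"
    then obtain n where n: "n \<ge> 1" "int i = \<lfloor>\<gamma> ^ n\<rfloor>"
      by (auto simp: branching_radii_def)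
    have "\<gamma> ^ n < real j"
      using n(2) i by simp linarith
    thus "i \<in> (\<lambda>n. nat \<lfloor>\<gamma> ^ n\<rfloor>) ` N"
      using n by (auto simp: N_def intro!: image_eqI[of _ _ n])
  qed
  hence "card (branching_radii \<gamma> \<inter> {..<j}) \<le> card N"
    using \<open>finite N\<close> by (meson card_image_le card_mono finite_imageI le_trans)
  also have "\<dots> \<le> nat \<lfloor>log \<gamma> (real j)\<rfloor>"
    using card_mono[OF _ N] by simp
  finally have "real (card (branching_radii \<gamma> \<inter> {..<j})) \<le> real (nat \<lfloor>log \<gamma> (real j)\<rfloor>)"
    by simp
  also have "\<dots> \<le> log \<gamma> (real j)"
    using assms by (simp add: of_nat_floor)
  finally show ?thesis .
qed

text \<open>
  The gap \<open>\<gamma> ^ n * (\<gamma> - 1)\<close> between consecutive powers eventually exceeds 1, and from then on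
  distinct powers have distinct integer parts. So only boundedly many exponents are lost.
\<close>

lemma card_branching_radii_ge:
  assumes "\<gamma> > 1"
  obtains m where "\<And>j. j \<ge> 1 \<Longrightarrow>
    log \<gamma> (real j) - real m \<le> real (card (branching_radii \<gamma> \<inter> {..<j}))"
proof -
  obtain n0 where n0: "1 / (\<gamma> - 1) < \<gamma> ^ n0"
    using real_arch_pow[OF assms] by blast
  \<comment> \<open>The successor ensures that all exponents from \<open>m\<close> on are positive.\<close>
  define m where "m = Suc n0"
  have step: "\<gamma> ^ a + 1 \<le> \<gamma> ^ b" if "m \<le> a" "a < b" for a b
  proof -
    have "1 / (\<gamma> - 1) \<le> \<gamma> ^ a"
      using n0 power_increasing[of n0 a \<gamma>] that(1) assms unfolding m_def by linarith
    hence "1 \<le> \<gamma> ^ a * (\<gamma> - 1)"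
      using assms by (simp add: field_simps)
    hence "\<gamma> ^ a + 1 \<le> \<gamma> ^ Suc a"
      by (simp add: algebra_simps)
    also have "\<dots> \<le> \<gamma> ^ b"
      using that assms by (intro power_increasing) auto
    finally show ?thesis .
  qed
  have "log \<gamma> (real j) - real m \<le> real (card (branching_radii \<gamma> \<inter> {..<j}))" if "j \<ge> 1" for j
  proof -
    define N where "N = {m..<nat \<lceil>log \<gamma> (real j)\<rceil>}"
    have inj: "inj_on (\<lambda>n. nat \<lfloor>\<gamma> ^ n\<rfloor>) N"
    proof (rule linorder_inj_onI)
      fix a b assume "a < b" "a \<in> N" "b \<in> N"
      hence "\<gamma> ^ a + 1 \<le> \<gamma> ^ b"
        by (intro step) (auto simp: N_def)
      moreover have "0 \<le> \<gamma> ^ a"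
        using assms by simp
      ultimately show "nat \<lfloor>\<gamma> ^ a\<rfloor> \<noteq> nat \<lfloor>\<gamma> ^ b\<rfloor>"
        by linarith
    qed auto
    have "(\<lambda>n. nat \<lfloor>\<gamma> ^ n\<rfloor>) ` N \<subseteq> branching_radii \<gamma> \<inter> {..<j}"
    proof
      fix i assume "i \<in> (\<lambda>n. nat \<lfloor>\<gamma> ^ n\<rfloor>) ` N"
      then obtain n where n: "n \<in> N" "i = nat \<lfloor>\<gamma> ^ n\<rfloor>"
        by blast
      have "real n < log \<gamma> (real j)"
        using n(1) unfolding N_def atLeastLessThan_iff by linarith
      hence "\<gamma> ^ n < real j"
        using assms that by (simp add: power_less_iff_less_log)
      moreover have "0 \<le> \<gamma> ^ n"
        using assms by simp
      ultimately have "i < j" "int i = \<lfloor>\<gamma> ^ n\<rfloor>"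
        using n(2) by linarith+
      moreover have "n \<ge> 1"
        using n(1) by (simp add: N_def m_def)
      ultimately show "i \<in> branching_radii \<gamma> \<inter> {..<j}"
        by (auto simp: branching_radii_def)
    qed
    hence "card N \<le> card (branching_radii \<gamma> \<inter> {..<j})"
      by (intro card_inj_on_le[OF inj]) auto
    thus ?thesis
      unfolding N_def card_atLeastLessThan by linarith
  qed
  thus ?thesis
    using that by blast
qed

lemma powr_log_swap:
  fixes b x y :: real
  assumes "b > 1" "x > 0" "y > 0"
  shows "y powr log b x = x powr log b y"
  using assms by (simp add: powr_def log_def)


section \<open>Growth of the balls\<close>

text \<open>
  Constant factors become additive constants under the logarithm and vanish after division by
  \<open>ln r\<close>, which tends to infinity.
\<close>

lemma ln_over_ln_tendsto:
  fixes f :: "real \<Rightarrow> real" and c C a :: real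
  assumes "c > 0" "C > 0"
    and lower: "eventually (\<lambda>r. c * r powr a \<le> f r) at_top"
    and upper: "eventually (\<lambda>r. f r \<le> C * r powr a) at_top"
  shows "((\<lambda>r. ln (f r) / ln r) \<longlongrightarrow> a) at_top"
proof (rule tendsto_sandwich)
  have split: "ln (d * r powr a) = ln d + a * ln r" if "d > 0" "r > 1" for d r :: real
    using that by (simp add: ln_mult ln_powr)
  show "\<forall>\<^sub>F r in at_top. (ln c + a * ln r) / ln r \<le> ln (f r) / ln r"
    using lower eventually_gt_at_top[of 1]
  proof eventually_elim
    case (elim r)
    have "0 < c * r powr a"
      using assms elim by simp
    hence "ln (c * r powr a) \<le> ln (f r)"
      using elim by simp
    thus ?case
      using elim assms split[of c r] by (intro divide_right_mono) auto
  qed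
  show "\<forall>\<^sub>F r in at_top. ln (f r) / ln r \<le> (ln C + a * ln r) / ln r"
    using lower upper eventually_gt_at_top[of 1]
  proof eventually_elim
    case (elim r)
    have "0 < c * r powr a"
      using assms elim by simp
    hence "ln (f r) \<le> ln (C * r powr a)"
      using elim by simp
    thus ?case
      using elim assms split[of C r] by (intro divide_right_mono) auto
  qed
  show "((\<lambda>r. (ln c + a * ln r) / ln r) \<longlongrightarrow> a) at_top"
    by real_asymp
  show "((\<lambda>r. (ln C + a * ln r) / ln r) \<longlongrightarrow> a) at_top"
    by real_asymp
qed

text \<open>
  For the lower bound, with \<open>m = nat \<lfloor>r\<rfloor>\<close>, it suffices to keep the summands with \<open>j > m div 2\<close>.
  There are at least \<open>m / 2\<close> of them, each of size at least \<open>c * (m / 2) powr b\<close>, and \<open>m / 2\<close> is at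
  least \<open>r / 4\<close>, which is where the constant comes from.
\<close>

lemma sum_powr_growth_bounds:
  fixes M :: "nat \<Rightarrow> real" and b c :: real
  assumes "b \<ge> 0" "c > 0" "M 0 \<le> 1" "\<And>j. M j \<ge> 0"
    and lower: "\<And>j. j \<ge> 1 \<Longrightarrow> c * real j powr b \<le> M j"
    and upper: "\<And>j. j \<ge> 1 \<Longrightarrow> M j \<le> real j powr b"
    and "r \<ge> 1"
  shows "c * (1 / 4) powr (b + 1) * r powr (b + 1) \<le> (\<Sum>j\<le>nat \<lfloor>r\<rfloor>. M j)"
    and "(\<Sum>j\<le>nat \<lfloor>r\<rfloor>. M j) \<le> 2 * r powr (b + 1)"
proof -
  define m where "m = nat \<lfloor>r\<rfloor>"
  have m: "real m \<le> r" "r / 2 \<le> real m" "m \<ge> 1"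
  proof -
    have "1 \<le> \<lfloor>r\<rfloor>"
      using \<open>r \<ge> 1\<close> by simp
    hence "real m = of_int \<lfloor>r\<rfloor>" "m \<ge> 1"
      unfolding m_def by linarith+
    moreover have "r / 2 \<le> of_int \<lfloor>r\<rfloor>"
      using \<open>1 \<le> \<lfloor>r\<rfloor>\<close> by linarith
    ultimately show "real m \<le> r" "r / 2 \<le> real m" "m \<ge> 1"
      by auto
  qed
  have "c * (1 / 4) powr (b + 1) * r powr (b + 1) = c * (r / 4) powr (b + 1)"
    using \<open>r \<ge> 1\<close> by (simp add: powr_divide)
  also have "\<dots> = (r / 4) * (c * (r / 4) powr b)"
    using \<open>r \<ge> 1\<close> by (simp add: powr_add)
  also have "\<dots> \<le> real (card {m div 2<..m}) * (c * (r / 4) powr b)"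
  proof (intro mult_right_mono)
    have "real m / 2 \<le> real (m - m div 2)"
      by linarith
    thus "r / 4 \<le> real (card {m div 2<..m})"
      using m by simp
  qed (use assms in auto)
  also have "\<dots> \<le> (\<Sum>j\<in>{m div 2<..m}. M j)"
  proof (rule sum_bounded_below)
    fix j assume "j \<in> {m div 2<..m}"
    hence j: "real m / 2 \<le> real j" "j \<ge> 1"
      by auto
    hence "(r / 4) powr b \<le> real j powr b"
      using m \<open>r \<ge> 1\<close> \<open>b \<ge> 0\<close> by (intro powr_mono2) auto
    thus "c * (r / 4) powr b \<le> M j"
      using lower[OF j(2)] \<open>c > 0\<close> by (meson mult_left_mono less_imp_le order_trans)
  qed
  also have "\<dots> \<le> (\<Sum>j\<le>m. M j)"
    using assms by (intro sum_mono2) auto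
  finally show "c * (1 / 4) powr (b + 1) * r powr (b + 1) \<le> (\<Sum>j\<le>nat \<lfloor>r\<rfloor>. M j)"
    by (simp add: m_def)
  have "M j \<le> r powr b" if "j \<le> m" for j
  proof (cases "j = 0")
    case True
    thus ?thesis
      using \<open>M 0 \<le> 1\<close> ge_one_powr_ge_zero[OF \<open>r \<ge> 1\<close> \<open>b \<ge> 0\<close>] by simp
  next
    case False
    hence "real j powr b \<le> r powr b"
      using that m \<open>b \<ge> 0\<close> by (intro powr_mono2) auto
    thus ?thesis
      using upper[of j] False by simp
  qed
  hence "(\<Sum>j\<le>m. M j) \<le> real (card {..m}) * r powr b"
    by (intro sum_bounded_above) auto
  also have "\<dots> \<le> (2 * r) * r powr b"
    using m \<open>r \<ge> 1\<close> by (intro mult_right_mono) auto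
  also have "\<dots> = 2 * r powr (b + 1)"
    using \<open>r \<ge> 1\<close> by (simp add: powr_add)
  finally show "(\<Sum>j\<le>nat \<lfloor>r\<rfloor>. M j) \<le> 2 * r powr (b + 1)"
    by (simp add: m_def)
qed

theorem proposition4p1:
  fixes \<gamma> :: real and k :: nat and \<Gamma> :: "('a, 'b) pre_digraph" and rt :: 'a
  assumes "\<gamma> > 1" and "k \<ge> 2" and "is_Gamma k \<gamma> \<Gamma> rt"
  shows "Limsup at_top (\<lambda>r::real. ereal (ln (real (card (rooted_tree.root_ball \<Gamma> rt r))) / ln r))
           = ereal (ln (\<gamma> * real k) / ln \<gamma>)
       \<and> Liminf at_top (\<lambda>r::real. ereal (ln (real (card (rooted_tree.root_ball \<Gamma> rt r))) / ln r))
           = ereal (ln (\<gamma> * real k) / ln \<gamma>)"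
proof -
  have tree: "rooted_tree \<Gamma> rt"
    and sh: "rooted_tree.spherically_homogeneous \<Gamma> rt (Gamma_branching k \<gamma>)"
    using assms(3) by (auto simp: is_Gamma_def)
  define b where "b = log \<gamma> (real k)"
  define M where "M j = real k ^ card (branching_radii \<gamma> \<inter> {..<j})" for j
  have M_powr: "M j = real k powr real (card (branching_radii \<gamma> \<inter> {..<j}))" for j
    using assms(2) by (simp add: M_def powr_realpow)
  have ball: "real (card (rooted_tree.root_ball \<Gamma> rt r)) = (\<Sum>j\<le>nat \<lfloor>r\<rfloor>. M j)" if "r \<ge> 1" for r
    using that by (simp add: rooted_tree.card_root_ball[OF tree sh] prod_Gamma_branching M_def)
  have b: "b \<ge> 0"
    using assms by (simp add: b_def)
  have k_powr_log: "real k powr log \<gamma> (real j) = real j powr b" if "j \<ge> 1" for j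
    unfolding b_def using assms that by (intro powr_log_swap) auto
  obtain m where m: "\<And>j. j \<ge> 1 \<Longrightarrow>
      log \<gamma> (real j) - real m \<le> real (card (branching_radii \<gamma> \<inter> {..<j}))"
    using card_branching_radii_ge[OF assms(1)] by blast
  define c where "c = real k powr (- real m)"
  have c: "c > 0"
    using assms by (simp add: c_def)
  have upper: "M j \<le> real j powr b" if "j \<ge> 1" for j
    unfolding M_powr k_powr_log[OF that, symmetric]
    using card_branching_radii_le[OF assms(1) that] assms(2) by (intro powr_mono) auto
  have lower: "c * real j powr b \<le> M j" if "j \<ge> 1" for j
  proof -
    have "c * real j powr b = real k powr (log \<gamma> (real j) - real m)"
      by (simp add: c_def k_powr_log[OF that, symmetric] powr_diff powr_minus field_simps)
    also have "\<dots> \<le> M j"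
      unfolding M_powr using m[OF that] assms(2) by (intro powr_mono) auto
    finally show ?thesis .
  qed
  have M: "M 0 \<le> 1" "\<And>j. M j \<ge> 0"
    by (auto simp: M_def)
  note bounds = sum_powr_growth_bounds[OF b c M lower upper]
  have "((\<lambda>r. ln (real (card (rooted_tree.root_ball \<Gamma> rt r))) / ln r) \<longlongrightarrow> b + 1) at_top"
  proof (rule ln_over_ln_tendsto)
    show "\<forall>\<^sub>F r in at_top. c * (1 / 4) powr (b + 1) * r powr (b + 1)
            \<le> real (card (rooted_tree.root_ball \<Gamma> rt r))"
      using eventually_ge_at_top[of 1] by eventually_elim (use bounds(1) ball in auto)
    show "\<forall>\<^sub>F r in at_top. real (card (rooted_tree.root_ball \<Gamma> rt r)) \<le> 2 * r powr (b + 1)"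
      using eventually_ge_at_top[of 1] by eventually_elim (use bounds(2) ball in auto)
  qed (use c in auto)
  also have "b + 1 = ln (\<gamma> * real k) / ln \<gamma>"
    using assms by (simp add: b_def log_def ln_mult field_simps)
  finally have "((\<lambda>r. ereal (ln (real (card (rooted_tree.root_ball \<Gamma> rt r))) / ln r))
      \<longlongrightarrow> ereal (ln (\<gamma> * real k) / ln \<gamma>)) at_top"
    by simp
  thus ?thesis
    by (intro conjI lim_imp_Limsup lim_imp_Liminf) auto
qed

end
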